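(* Let $D\subseteq\mathbb{R}^k$ be an open set with $0\in D$, let $\Omega\subseteq D$ with $0\in\Omega$, let $S=\{0\}$, let $h:D\to\mathbb{R}^m$ be continuous with $h(0)=0$, and let $f:D\times D\times D\to\mathbb{R}^k$ be locally Lipschitz. For $n\in\mathbb{N}$ let $(\Sigma_n)$ be the string $\dot x_i=f(x_{i-1},x_i,x_{i+1})$, $y_i=h(x_i)$, $i=1,\dots,n$, with $x_0=u\in\Omega$, $x_{n+1}=w\in S=\{0\}$. Suppose that $(\Sigma_n)$ is forward complete for every $n\in\mathbb{N}$. Let $p\in[1,+\infty]$ and suppose that there exist $Q\in C^0(D;\mathbb{R}_+)$ and constants $\gamma>0$, $\delta\ge 0$ such that for every $\xi\in D$ and $u,w\in\mho(D)$, the solution of the initial value problem $$\dot x=f(u,x,w),\quad y=h(x),\quad x\in D,\qquad x(0)=\xi$$ exists and satisfies, for all $t\ge 0$, $$\|y\|_{[0,t],p}\le\gamma\|h(u)\|_{[0,t],p}+\delta\|h(w)\|_{[0,t],p}+Q(\xi).$$ Define $\theta(\gamma,\delta)=\gamma+\delta$ for $\delta<\gamma$ and $\theta(\gamma,\delta)=2\sqrt{\gamma\delta}$ for $\delta\ge\gamma$. If $\theta(\gamma,\delta)<1$, then the string $(\Sigma_n)_{n\in\mathbb{N}}$ with $S=\{0\}$ is $L^p$ string stable (i.e. the string is $L^p$ one-sided string stable); moreover, the string stability estimate $$\|y_i\|_{[0,t],p}\le a_1\left(\|h(u)\|_{[0,t],p}\right)+a_2\left(\|h(w)\|_{[0,t],p}\right)+Q_n(\xi)$$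 (for all $n\in\mathbb{N}$, $\xi\in D^n$, $u\in\mho(\Omega)$, $w\in\mho(S)$, $t\ge0$, $i=1,\dots,n$, along the solution of $(\Sigma_n)$ with $x(0)=\xi$) holds with $a_1(s)=\frac{\gamma s}{1-\theta(\gamma,\delta)}$ for all $s\ge0$, $a_2(s)\equiv0$ and $$Q_n(\xi_1,\dots,\xi_n)=\frac{\max\left(1,(\gamma^{-1}\delta)^{(n-1)/2}\right)}{1-\theta(\gamma,\delta)}\max_{i=1,\dots,n}Q(\xi_i)\quad\text{for all }(\xi_1,\dots,\xi_n)\in D^n.$$
   Context: Notation. $\mathbb{R}_+=[0,+\infty)$ and $|\cdot|$ is the Euclidean norm. For a set $A\subseteq\mathbb{R}^q$, $\mho(A)$ is the set of Lebesgue measurable, locally essentially bounded functions $u:\mathbb{R}_+\to A$ such that for every $T>0$ there is a compact set $\Omega_T\subseteq A$ with $u(t)\in\Omega_T$ for almost every $t\in[0,T]$. For a locally essentially bounded measurable signal $y$ on $\mathbb{R}_+$ and $t\ge0$: $\|y\|_{[0,t],p}=\left(\int_0^t|y(s)|^p\,ds\right)^{1/p}$ if $p\in[1,+\infty)$, and $\|y\|_{[0,t],\infty}$ is the (essential) supremum of $|y(s)|$ over $s\in[0,t]$. Forward completeness. The state of $(\Sigma_n)$ is $x=(x_1,\dots,x_n)\in D^n$. The system $(\Sigma_n)$ is forward complete if for every $\xi\in D^n$, $u\in\mho(\Omega)$, $w\in\mho(S)$ the (unique, Carathéodory) solution $x(t)\in D^n$ with $x(0)=\xi$ exists for all $t\ge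 0$. $L^p$ string stability. For $p\in[1,+\infty]$, the string $(\Sigma_n)_{n\in\mathbb{N}}$ (with input sets $\Omega,S$) is $L^p$ string stable if there exist non-decreasing functions $a_1,a_2\in C^0(\mathbb{R}_+;\mathbb{R}_+)$, independent of $n$, such that for every $n\in\mathbb{N}$: (i) $(\Sigma_n)$ is forward complete, and (ii) there exists $Q_n\in C^0(D^n;\mathbb{R}_+)$ such that for every $\xi\in D^n$, $u\in\mho(\Omega)$, $w\in\mho(S)$ the solution of $(\Sigma_n)$ with $x(0)=\xi$ satisfies, for all $t\ge0$ and $i=1,\dots,n$, $\|y_i\|_{[0,t],p}\le a_1(\|h(u)\|_{[0,t],p})+a_2(\|h(w)\|_{[0,t],p})+Q_n(\xi)$. The string is called $L^p$ one-sided string stable when it is $L^p$ string stable with $S=\{0\}$. *)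

theory Defs
  imports "HOL-Analysis.Analysis" "HOL-Probability.Essential_Supremum"
begin

definition locally_lipschitz_on :: "'a::metric_space set \<Rightarrow> ('a \<Rightarrow> 'b::metric_space) \<Rightarrow> bool" where
  "locally_lipschitz_on U f \<longleftrightarrow> (\<forall>z\<in>U. \<exists>r>0. \<exists>L. L-lipschitz_on (cball z r \<inter> U) f)"

(* Signals are functions on the whole real line of which only the restriction to {0..} matters. *)

definition loc_ess_bounded :: "(real \<Rightarrow> 'a::euclidean_space) \<Rightarrow> bool" where
  "loc_ess_bounded u \<longleftrightarrow> (\<forall>T>0. \<exists>C. AE t in lebesgue_on {0..T}. norm (u t) \<le> C)"

definition mho :: "'a::euclidean_space set \<Rightarrow> (real \<Rightarrow> 'a) set" where
  "mho A = {u. u \<in> borel_measurable (lebesgue_on {0..}) \<and> (\<forall>t\<ge>0. u t \<in> A) \<and>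
     loc_ess_bounded u \<and>
     (\<forall>T>0. \<exists>K. compact K \<and> K \<subseteq> A \<and> (AE t in lebesgue_on {0..T}. u t \<in> K))}"

(* Norm of y on {0..t} for 1 <= p <= \<infinity>.  It is real-valued because it is only applied to
   measurable, locally essentially bounded signals, for which the integral and the essential
   supremum are finite.  For t = 0 the value is 0, also when p = \<infinity> (the essential supremum
   in ennreal over a null set is 0). *)
definition Lp_norm :: "ereal \<Rightarrow> real \<Rightarrow> (real \<Rightarrow> 'a::euclidean_space) \<Rightarrow> real" where
  "Lp_norm p t y =
     (if p = \<infinity> then enn2real (esssup (lebesgue_on {0..t}) (\<lambda>s. ennreal (norm (y s))))
      else (LINT s|lebesgue_on {0..t}. norm (y s) powr real_of_ereal p) powr (1 / real_of_ereal p))"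

definition abs_continuous_on :: "real \<Rightarrow> real \<Rightarrow> (real \<Rightarrow> 'a::euclidean_space) \<Rightarrow> bool" where
  "abs_continuous_on a b x \<longleftrightarrow>
     (\<forall>\<epsilon>>0. \<exists>\<delta>>0. \<forall>(N::nat) l r.
        (\<forall>j<N. a \<le> l j \<and> l j \<le> r j \<and> r j \<le> b) \<and>
        disjoint_family_on (\<lambda>j. {l j<..<r j}) {..<N} \<and>
        (\<Sum>j<N. r j - l j) < \<delta> \<longrightarrow>
        (\<Sum>j<N. norm (x (r j) - x (l j))) < \<epsilon>)"

(* Global Caratheodory solution, on {0..}, of x' = f(u,x,w), x(0) = \<xi>, x in D. *)
definition subsystem_solution ::
  "'a::euclidean_space set \<Rightarrow> ('a \<times> 'a \<times> 'a \<Rightarrow> 'a) \<Rightarrow> (real \<Rightarrow> 'a) \<Rightarrow> (real \<Rightarrow> 'a) \<Rightarrow> 'a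
     \<Rightarrow> (real \<Rightarrow> 'a) \<Rightarrow> bool" where
  "subsystem_solution D f u w \<xi> x \<longleftrightarrow>
     x 0 = \<xi> \<and> (\<forall>t\<ge>0. x t \<in> D) \<and>
     (\<forall>T>0. abs_continuous_on 0 T x) \<and>
     (AE t in lebesgue_on {0..}.
        (x has_vector_derivative f (u t, x t, w t)) (at t within {0..}))"

(* The n-fold power of D, with components indexed by 1,...,n; states are extensional functions,
   and the product topology on nat => 'a induces the usual topology on this set. *)
abbreviation state_space :: "nat \<Rightarrow> 'a set \<Rightarrow> (nat \<Rightarrow> 'a) set" where
  "state_space n D \<equiv> (\<Pi>\<^sub>E i\<in>{1..n}. D)"

(* Boundary conventions: component 0 is the input u, component n+1 is the input w. *)
definition ext_state :: "nat \<Rightarrow> 'a \<Rightarrow> 'a \<Rightarrow> (nat \<Rightarrow> 'a) \<Rightarrow> nat \<Rightarrow> 'a" where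
  "ext_state n u w x i = (if i = 0 then u else if i = n + 1 then w else x i)"

(* Global Caratheodory solution, on {0..}, of the string with n subsystems. *)
definition string_solution ::
  "'a::euclidean_space set \<Rightarrow> ('a \<times> 'a \<times> 'a \<Rightarrow> 'a) \<Rightarrow> nat \<Rightarrow> (real \<Rightarrow> 'a) \<Rightarrow> (real \<Rightarrow> 'a)
     \<Rightarrow> (nat \<Rightarrow> 'a) \<Rightarrow> (real \<Rightarrow> nat \<Rightarrow> 'a) \<Rightarrow> bool" where
  "string_solution D f n u w \<xi> x \<longleftrightarrow>
     x 0 = \<xi> \<and> (\<forall>t\<ge>0. x t \<in> state_space n D) \<and>
     (\<forall>i\<in>{1..n}. \<forall>T>0. abs_continuous_on 0 T (\<lambda>t. x t i)) \<and>
     (AE t in lebesgue_on {0..}. \<forall>i\<in>{1..n}.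
        ((\<lambda>s. x s i) has_vector_derivative
           (let X = ext_state n (u t) (w t) (x t) in f (X (i - 1), X i, X (i + 1))))
        (at t within {0..}))"

(* Solutions are unique when f is locally Lipschitz, so existence is all that is required here,
   and estimates along "the" solution are stated below for every solution. *)
definition forward_complete ::
  "'a::euclidean_space set \<Rightarrow> 'a set \<Rightarrow> 'a set \<Rightarrow> ('a \<times> 'a \<times> 'a \<Rightarrow> 'a) \<Rightarrow> nat \<Rightarrow> bool" where
  "forward_complete D \<Omega> S f n \<longleftrightarrow>
     (\<forall>\<xi>\<in>state_space n D. \<forall>u\<in>mho \<Omega>. \<forall>w\<in>mho S. \<exists>x. string_solution D f n u w \<xi> x)"

definition string_estimate ::
  "'a::euclidean_space set \<Rightarrow> 'a set \<Rightarrow> 'a set \<Rightarrow> ('a \<times> 'a \<times> 'a \<Rightarrow> 'a) \<Rightarrow> ('a \<Rightarrow> 'b::euclidean_space)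
     \<Rightarrow> ereal \<Rightarrow> nat \<Rightarrow> (real \<Rightarrow> real) \<Rightarrow> (real \<Rightarrow> real) \<Rightarrow> ((nat \<Rightarrow> 'a) \<Rightarrow> real) \<Rightarrow> bool" where
  "string_estimate D \<Omega> S f h p n a\<^sub>1 a\<^sub>2 Q \<longleftrightarrow>
     (\<forall>\<xi>\<in>state_space n D. \<forall>u\<in>mho \<Omega>. \<forall>w\<in>mho S. \<forall>x. string_solution D f n u w \<xi> x \<longrightarrow>
        (\<forall>t\<ge>0. \<forall>i\<in>{1..n}.
           Lp_norm p t (\<lambda>s. h (x s i)) \<le>
             a\<^sub>1 (Lp_norm p t (\<lambda>s. h (u s))) + a\<^sub>2 (Lp_norm p t (\<lambda>s. h (w s))) + Q \<xi>))"

definition string_stable ::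
  "'a::euclidean_space set \<Rightarrow> 'a set \<Rightarrow> 'a set \<Rightarrow> ('a \<times> 'a \<times> 'a \<Rightarrow> 'a) \<Rightarrow> ('a \<Rightarrow> 'b::euclidean_space)
     \<Rightarrow> ereal \<Rightarrow> bool" where
  "string_stable D \<Omega> S f h p \<longleftrightarrow>
     (\<exists>a\<^sub>1 a\<^sub>2 :: real \<Rightarrow> real.
        (\<forall>a\<in>{a\<^sub>1, a\<^sub>2}. continuous_on {0..} a \<and> mono_on {0..} a \<and> (\<forall>s\<ge>0. 0 \<le> a s)) \<and>
        (\<forall>n\<ge>1. forward_complete D \<Omega> S f n \<and>
           (\<exists>Q. continuous_on (state_space n D) Q \<and> (\<forall>\<xi>\<in>state_space n D. 0 \<le> Q \<xi>) \<and>
              string_estimate D \<Omega> S f h p n a\<^sub>1 a\<^sub>2 Q)))"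

definition one_sided_string_stable ::
  "'a::euclidean_space set \<Rightarrow> 'a set \<Rightarrow> ('a \<times> 'a \<times> 'a \<Rightarrow> 'a) \<Rightarrow> ('a \<Rightarrow> 'b::euclidean_space)
     \<Rightarrow> ereal \<Rightarrow> bool" where
  "one_sided_string_stable D \<Omega> f h p \<longleftrightarrow> string_stable D \<Omega> {0} f h p"

definition theta :: "real \<Rightarrow> real \<Rightarrow> real" where
  "theta \<gamma> \<delta> = (if \<delta> < \<gamma> then \<gamma> + \<delta> else 2 * sqrt (\<gamma> * \<delta>))"

end

theory Submission
  imports Defs
begin

text \<open>The output norms \<open>a\<^sub>i = \<parallel>y\<^sub>i\<parallel>\<close> satisfy
  \<open>a\<^sub>i \<le> \<gamma> a\<^sub>i\<^sub>-\<^sub>1 + \<delta> a\<^sub>i\<^sub>+\<^sub>1 + Q(\<xi>\<^sub>i)\<close>, because every component of a solution of the string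
  solves the subsystem equation with its two neighbours as inputs.  With the weight
  \<open>r = max 1 (sqrt (\<delta> / \<gamma>))\<close> one has \<open>\<gamma> r + \<delta> / r = \<theta>(\<gamma>, \<delta>) < 1\<close>, so the recursion is a
  contraction in the norm \<open>max\<^sub>i r\<^sup>i a\<^sub>i\<close>; evaluating it where the maximum is attained gives
  the estimate.\<close>

section \<open>The scalar recursion for the output norms, and the choice of its weight\<close>

lemma tridiagonal_estimate:
  fixes a :: "nat \<Rightarrow> real"
  assumes r: "1 \<le> r" and lt1: "\<gamma> * r + \<delta> / r < 1"
    and nonneg: "0 \<le> \<gamma>" "0 \<le> \<delta>" "0 \<le> q" "0 \<le> a 0" "a (n + 1) = 0"
    and rec: "\<And>i. i \<in> {1..n} \<Longrightarrow> 0 \<le> a i \<and> a i \<le> \<gamma> * a (i - 1) + \<delta> * a (i + 1) + q"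
    and i: "i \<in> {1..n}"
  shows "a i \<le> (\<gamma> * a 0 + r ^ (n - 1) * q) / (1 - (\<gamma> * r + \<delta> / r))"
proof -
  define b where "b j = r ^ j * a j" for j
  define M where "M = (MAX j\<in>{1..n}. b j)"
  define t where "t = \<gamma> * r + \<delta> / r"
  have fin: "finite (b ` {1..n})" "b ` {1..n} \<noteq> {}"
    using i by auto
  have le_M: "b j \<le> M" if "j \<in> {1..n}" for j
    unfolding M_def using fin(1) that by simp
  obtain j where j: "j \<in> {1..n}" and Mj: "M = b j"
    using Max_in[OF fin] unfolding M_def by auto
  have "0 \<le> b j"
    using rec[OF j] r by (simp add: b_def)
  then have M0: "0 \<le> M"
    by (simp add: Mj)
  have "b j \<le> r ^ j * (\<gamma> * a (j - 1) + \<delta> * a (j + 1) + q)"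
    unfolding b_def using rec[OF j] r by (intro mult_left_mono) auto
  \<comment> \<open>Shifting the index by one costs a factor \<open>r\<close> for the predecessor
    and \<open>1 / r\<close> for the successor; this is where the contraction constant
    \<open>\<gamma> * r + \<delta> / r\<close> comes from.\<close>
  also have "\<dots> = (\<gamma> * r) * b (j - 1) + (\<delta> / r) * b (j + 1) + r ^ j * q"
    using r j by (cases j) (auto simp: b_def field_simps)
  finally have bj: "b j \<le> (\<gamma> * r) * b (j - 1) + (\<delta> / r) * b (j + 1) + r ^ j * q" .
  \<comment> \<open>For \<open>j = n\<close> the successor is the zero boundary value, so
    \<open>0 \<le> M\<close> suffices.\<close>
  have "b (j + 1) \<le> M"
    using le_M[of "j + 1"] j M0 nonneg(5) by (cases "j = n") (auto simp: b_def)
  then have up: "(\<delta> / r) * b (j + 1) \<le> (\<delta> / r) * M"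
    using r nonneg by (intro mult_left_mono) auto
  have a0: "0 \<le> r * (\<gamma> * a 0)"
    using r nonneg by auto
  have rq: "r ^ j * q \<le> r ^ n * q"
    using r j nonneg by (intro mult_right_mono power_increasing) auto
  have "M * (1 - t) \<le> r * (\<gamma> * a 0) + r ^ n * q"
  proof (cases "j = 1")
    case True
    \<comment> \<open>Here \<open>b (j - 1)\<close> is \<open>a 0\<close>, which \<open>M\<close>
      does not bound. It stays on the right-hand side, and this nonnegative term is added so that
      both cases have the same left-hand side.\<close>
    have "0 \<le> (\<gamma> * r) * M"
      using r nonneg M0 by auto
    then show ?thesis
      using True bj up rq by (simp add: Mj t_def algebra_simps b_def)
  next
    case False
    then have "(\<gamma> * r) * b (j - 1) \<le> (\<gamma> * r) * M"
      using j r nonneg by (intro mult_left_mono le_M) auto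
    then show ?thesis
      using bj up rq a0 unfolding t_def Mj by (simp add: algebra_simps)
  qed
  also have "\<dots> = r * (\<gamma> * a 0 + r ^ (n - 1) * q)"
    using i by (cases n) (auto simp: algebra_simps)
  finally have M: "M * (1 - t) \<le> r * (\<gamma> * a 0 + r ^ (n - 1) * q)" .
  \<comment> \<open>Keeping one factor \<open>r\<close> on the left cancels the one in front of
    \<open>\<gamma> * a 0 + r ^ (n - 1) * q\<close>. Hence the gain from \<open>a 0\<close> does not
    depend on \<open>n\<close>.\<close>
  have "r ^ 1 * a i \<le> r ^ i * a i"
    using r i rec[OF i] by (intro mult_right_mono power_increasing) auto
  also have "\<dots> \<le> M"
    using le_M[OF i] by (simp add: b_def)
  finally have "r * a i * (1 - t) \<le> M * (1 - t)"
    using lt1 by (intro mult_right_mono) (auto simp: t_def)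
  with M have "r * (a i * (1 - t)) \<le> r * (\<gamma> * a 0 + r ^ (n - 1) * q)"
    by (simp add: mult.assoc)
  then have "a i * (1 - t) \<le> \<gamma> * a 0 + r ^ (n - 1) * q"
    using r by simp
  then show ?thesis
    using lt1 unfolding t_def by (simp add: pos_le_divide_eq)
qed

text \<open>The weight minimises \<open>\<gamma> * r + \<delta> / r\<close> over
  \<open>r \<ge> 1\<close>. For \<open>\<delta> \<ge> \<gamma>\<close> the minimum is the AM-GM
  value at \<open>sqrt (\<delta> / \<gamma>)\<close>; for \<open>\<delta> < \<gamma>\<close> the
  expression increases on \<open>r \<ge> 1\<close>, so the minimum is at
  \<open>r = 1\<close>.\<close>

lemma theta_weight:
  assumes "0 < \<gamma>" "0 \<le> \<delta>"
  shows "\<gamma> * max 1 (sqrt (\<delta> / \<gamma>)) + \<delta> / max 1 (sqrt (\<delta> / \<gamma>)) = theta \<gamma> \<delta>"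
proof (cases "\<delta> < \<gamma>")
  case True
  then have "max 1 (sqrt (\<delta> / \<gamma>)) = 1"
    using assms by (simp add: max_def)
  with True show ?thesis
    by (simp add: theta_def)
next
  case False
  define c d where "c = sqrt \<gamma>" and "d = sqrt \<delta>"
  have "0 < c" "0 < d" "\<gamma> = c * c" "\<delta> = d * d"
    using assms False by (auto simp: c_def d_def)
  moreover have "max 1 (sqrt (\<delta> / \<gamma>)) = d / c"
    using assms False by (simp add: max_def c_def d_def real_sqrt_divide)
  ultimately show ?thesis
    using False by (simp add: theta_def real_sqrt_mult field_simps)
qed

text \<open>With \<open>x = \<delta> / \<gamma>\<close> and \<open>k = n - 1\<close> this turns the
  power of the weight into the factor displayed in the bound on the initial state.\<close>

lemma power_max_sqrt:
  assumes "0 \<le> x"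
  shows "max 1 (sqrt x) ^ k = max 1 (x powr (real k / 2))"
proof (cases "1 \<le> x")
  case True
  have "sqrt x ^ k = x powr (real k / 2)"
    using True by (simp add: powr_half_sqrt[symmetric] powr_power)
  moreover have "1 \<le> sqrt x ^ k"
    using True by (intro one_le_power) simp
  ultimately show ?thesis
    using True by (simp add: max_def)
next
  case False
  \<comment> \<open>Both maxima are 1 here. This includes \<open>x = 0\<close> with
    \<open>k = 0\<close>, where \<open>powr\<close> gives 0 but the power gives 1.\<close>
  then have "x powr (real k / 2) \<le> 1"
    using assms by (intro powr_le1) auto
  with False show ?thesis
    by (simp add: max_def)
qed

section \<open>Output norms\<close>

lemma Lp_norm_nonneg: "0 \<le> Lp_norm p t y"
  by (simp add: Lp_norm_def)

lemma Lp_norm_eq_0: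
  assumes "\<And>s. 0 \<le> s \<Longrightarrow> y s = 0"
  shows "Lp_norm p t y = 0"
proof -
  \<comment> \<open>The bound on \<open>esssup\<close> requires measurability. Since
    \<open>y\<close> is known to vanish only on nonnegative times, it is compared with the constant
    0 on the restricted space.\<close>
  have "(\<lambda>s. ennreal (norm (y s))) \<in> borel_measurable (lebesgue_on {0..t}) \<longleftrightarrow>
      (\<lambda>s. 0 :: ennreal) \<in> borel_measurable (lebesgue_on {0..t})"
    using assms by (intro measurable_cong) auto
  then have "esssup (lebesgue_on {0..t}) (\<lambda>s. ennreal (norm (y s))) \<le> 0"
    using assms by (intro esssup_I AE_I2) auto
  then have "esssup (lebesgue_on {0..t}) (\<lambda>s. ennreal (norm (y s))) = 0"
    by simp
  moreover have "(LINT s|lebesgue_on {0..t}. norm (y s) powr real_of_ereal p) =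
      (LINT s|lebesgue_on {0..t}. 0)"
    using assms by (intro Bochner_Integration.integral_cong) auto
  ultimately show ?thesis
    by (simp add: Lp_norm_def)
qed

section \<open>Components of a string solution as admissible inputs and subsystem solutions\<close>

lemma abs_continuous_on_imp_continuous_on:
  assumes "abs_continuous_on a b x"
  shows "continuous_on {a..b} x"
proof (rule uniformly_continuous_imp_continuous, unfold uniformly_continuous_on_def, intro allI impI)
  fix e :: real
  assume "0 < e"
  obtain d where d: "0 < d" and small: "\<forall>(N::nat) l r.
        (\<forall>j<N. a \<le> l j \<and> l j \<le> r j \<and> r j \<le> b) \<and>
        disjoint_family_on (\<lambda>j. {l j<..<r j}) {..<N} \<and> (\<Sum>j<N. r j - l j) < d \<longrightarrow>
        (\<Sum>j<N. norm (x (r j) - x (l j))) < e"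
    using mp[OF spec[OF assms[unfolded abs_continuous_on_def]] \<open>0 < e\<close>]
    by (elim exE conjE) (rule that)
  \<comment> \<open>Absolute continuity applied to a family with a single interval.\<close>
  have *: "norm (x t - x s) < e" if "a \<le> s" "s \<le> t" "t \<le> b" "t - s < d" for s t
    using spec[OF spec[OF spec[OF small, of 1], of "\<lambda>_. s"], of "\<lambda>_. t"] that by (simp add: disjoint_family_on_def)
  have "dist (x t) (x s) < e" if "s \<in> {a..b}" "t \<in> {a..b}" "dist t s < d" for s t
    using *[of s t] *[of t s] that by (cases "s \<le> t") (auto simp: dist_norm norm_minus_commute)
  with d show "\<exists>d>0. \<forall>s\<in>{a..b}. \<forall>t\<in>{a..b}. dist t s < d \<longrightarrow> dist (x t) (x s) < e"
    by blast
qed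

text \<open>The image of \<open>{0..T}\<close> serves both as the compact subset of \<open>D\<close>
  and as the source of the local bound.\<close>

lemma continuous_in_mho:
  fixes x :: "real \<Rightarrow> 'a::euclidean_space"
  assumes cont: "\<And>T. 0 < T \<Longrightarrow> continuous_on {0..T} x"
    and D: "\<And>t. 0 \<le> t \<Longrightarrow> x t \<in> D"
  shows "x \<in> mho D"
proof -
  have "continuous_on {0..} x"
    unfolding continuous_on_eq_continuous_within
  proof
    fix t :: real
    assume "t \<in> {0..}"
    \<comment> \<open>Continuity is local: \<open>{0..t + 1}\<close> and \<open>{0..}\<close> agree
      near \<open>t\<close>.\<close>
    then have "(x \<longlongrightarrow> x t) (at t within {0..t + 1})"
      using cont[of "t + 1"] by (auto simp: continuous_on_def)
    moreover have "at t within {0..t + 1} = at t within {0..}"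
      by (rule at_within_nhd[of _ "{..<t + 1}"]) auto
    ultimately show "continuous (at t within {0..}) x"
      by (simp add: continuous_within)
  qed
  then have meas: "x \<in> borel_measurable (lebesgue_on {0..})"
    by (intro continuous_imp_measurable_on_sets_lebesgue) auto
  have K: "compact (x ` {0..T})" if "0 < T" for T
    using cont[OF that] by (intro compact_continuous_image) auto
  have "loc_ess_bounded x"
    unfolding loc_ess_bounded_def
  proof (intro allI impI)
    fix T :: real
    assume "0 < T"
    then obtain C where "\<forall>y\<in>x ` {0..T}. norm y \<le> C"
      using compact_imp_bounded[OF K] by (auto simp: bounded_iff)
    then show "\<exists>C. AE t in lebesgue_on {0..T}. norm (x t) \<le> C"
      by (intro exI[of _ C] AE_I2) auto
  qed
  moreover have "\<exists>K. compact K \<and> K \<subseteq> D \<and> (AE t in lebesgue_on {0..T}. x t \<in> K)" if "0 < T" for T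
    using K[OF that] D by (intro exI[of _ "x ` {0..T}"] conjI AE_I2) auto
  ultimately show ?thesis
    using D meas unfolding mho_def by blast
qed

lemma mho_mono: "A \<subseteq> B \<Longrightarrow> mho A \<subseteq> mho B"
  unfolding mho_def by blast

text \<open>The subsystem estimate is assumed for all inputs in \<open>mho D\<close>, so the
  neighbours of a component have to be such inputs. Inner components qualify because they are
  continuous and stay in \<open>D\<close>.\<close>

lemma string_solution_ext_in_mho:
  assumes "string_solution D f n u w \<xi> x" "u \<in> mho D" "w \<in> mho D" "i \<le> n + 1"
  shows "(\<lambda>t. ext_state n (u t) (w t) (x t) i) \<in> mho D"
proof -
  consider "i = 0" | "i = n + 1" | "i \<in> {1..n}"
    using assms(4) by fastforce
  then show ?thesis
  proof cases
    case 3
    then have "(\<lambda>t. x t i) \<in> mho D"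
      using assms(1) unfolding string_solution_def
      by (intro continuous_in_mho abs_continuous_on_imp_continuous_on) (auto simp: PiE_iff)
    with 3 show ?thesis
      by (simp add: ext_state_def)
  qed (use assms in \<open>auto simp: ext_state_def\<close>)
qed

lemma string_solution_subsystem:
  assumes "string_solution D f n u w \<xi> x" "i \<in> {1..n}"
  shows "subsystem_solution D f (\<lambda>t. ext_state n (u t) (w t) (x t) (i - 1))
    (\<lambda>t. ext_state n (u t) (w t) (x t) (i + 1)) (\<xi> i) (\<lambda>t. x t i)"
proof -
  have "AE t in lebesgue_on {0..}. \<forall>j\<in>{1..n}. ((\<lambda>s. x s j) has_vector_derivative
      (let X = ext_state n (u t) (w t) (x t) in f (X (j - 1), X j, X (j + 1)))) (at t within {0..})"
    using assms(1) by (simp add: string_solution_def)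
  then have "AE t in lebesgue_on {0..}. ((\<lambda>s. x s i) has_vector_derivative
      f (ext_state n (u t) (w t) (x t) (i - 1), x t i, ext_state n (u t) (w t) (x t) (i + 1)))
      (at t within {0..})"
  proof (rule eventually_mono)
    fix t
    assume "\<forall>j\<in>{1..n}. ((\<lambda>s. x s j) has_vector_derivative
      (let X = ext_state n (u t) (w t) (x t) in f (X (j - 1), X j, X (j + 1)))) (at t within {0..})"
    moreover have "ext_state n (u t) (w t) (x t) i = x t i"
      using assms(2) by (simp add: ext_state_def)
    ultimately show "((\<lambda>s. x s i) has_vector_derivative
      f (ext_state n (u t) (w t) (x t) (i - 1), x t i, ext_state n (u t) (w t) (x t) (i + 1)))
      (at t within {0..})"
      using assms(2) by (metis (no_types, lifting))
  qed
  then show ?thesis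
    using assms by (auto simp: string_solution_def subsystem_solution_def PiE_iff)
qed

section \<open>Assembling the string estimate and stability\<close>

lemma continuous_on_Max_image:
  fixes g :: "'i \<Rightarrow> 'a::topological_space \<Rightarrow> real"
  assumes "finite I" "I \<noteq> {}" "\<And>i. i \<in> I \<Longrightarrow> continuous_on S (g i)"
  shows "continuous_on S (\<lambda>x. MAX i\<in>I. g i x)"
  using assms
proof (induction I rule: finite_ne_induct)
  case (insert i I)
  have "continuous_on S (\<lambda>x. max (g i x) (MAX i\<in>I. g i x))"
    using insert by (intro continuous_on_max) auto
  then show ?case
    using insert by simp
qed simp

theorem theorem3:
  fixes D \<Omega> :: "(real ^ 'k) set"
    and f :: "(real ^ 'k) \<times> (real ^ 'k) \<times> (real ^ 'k) \<Rightarrow> real ^ 'k"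
    and h :: "real ^ 'k \<Rightarrow> real ^ 'm"
    and p :: ereal
    and Q :: "real ^ 'k \<Rightarrow> real"
    and \<gamma> \<delta> :: real
  assumes "open D" and "0 \<in> D"
    and "\<Omega> \<subseteq> D" and "0 \<in> \<Omega>"
    and "continuous_on D h" and "h 0 = 0"
    and "locally_lipschitz_on (D \<times> D \<times> D) f"
    and "\<And>n. n \<ge> 1 \<Longrightarrow> forward_complete D \<Omega> {0} f n"
    and "1 \<le> p"
    and "continuous_on D Q" and "\<And>\<xi>. \<xi> \<in> D \<Longrightarrow> 0 \<le> Q \<xi>"
    and "\<gamma> > 0" and "\<delta> \<ge> 0"
    and "\<And>\<xi> u w. \<xi> \<in> D \<Longrightarrow> u \<in> mho D \<Longrightarrow> w \<in> mho D \<Longrightarrow>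
           (\<exists>x. subsystem_solution D f u w \<xi> x) \<and>
           (\<forall>x. subsystem_solution D f u w \<xi> x \<longrightarrow>
              (\<forall>t\<ge>0. Lp_norm p t (\<lambda>s. h (x s)) \<le>
                 \<gamma> * Lp_norm p t (\<lambda>s. h (u s)) + \<delta> * Lp_norm p t (\<lambda>s. h (w s)) + Q \<xi>))"
    and "theta \<gamma> \<delta> < 1"
  shows "one_sided_string_stable D \<Omega> f h p \<and>
    (\<forall>n\<ge>1. string_estimate D \<Omega> {0} f h p n
       (\<lambda>s. \<gamma> * s / (1 - theta \<gamma> \<delta>))
       (\<lambda>_. 0)
       (\<lambda>\<xi>. max 1 ((inverse \<gamma> * \<delta>) powr ((real n - 1) / 2)) / (1 - theta \<gamma> \<delta>) *
             (MAX i\<in>{1..n}. Q (\<xi> i))))"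
proof -
  define \<theta> where "\<theta> = theta \<gamma> \<delta>"
  have \<theta>: "\<theta> < 1"
    using assms(15) by (simp add: \<theta>_def)
  define c where "c n = max 1 ((inverse \<gamma> * \<delta>) powr ((real n - 1) / 2)) / (1 - \<theta>)" for n :: nat
  have c: "0 \<le> c n" for n
    using \<theta> by (simp add: c_def)
  have est: "string_estimate D \<Omega> {0} f h p n (\<lambda>s. \<gamma> * s / (1 - \<theta>)) (\<lambda>_. 0)
      (\<lambda>\<xi>. c n * (MAX i\<in>{1..n}. Q (\<xi> i)))" if n: "1 \<le> n" for n
    unfolding string_estimate_def
  proof (intro ballI allI impI)
    fix \<xi> u w x and t :: real and i
    assume \<xi>: "\<xi> \<in> state_space n D" and u: "u \<in> mho \<Omega>" and w: "w \<in> mho {0}"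
      and x: "string_solution D f n u w \<xi> x" and t: "0 \<le> t" and i: "i \<in> {1..n}"
    \<comment> \<open>Including the boundary signals, \<open>X 0\<close> being \<open>u\<close> and
      \<open>X (n + 1)\<close> being \<open>w\<close>, makes the recursion uniform over
      \<open>{1..n}\<close>.\<close>
    define X where "X j s = ext_state n (u s) (w s) (x s) j" for j s
    define a where "a j = Lp_norm p t (\<lambda>s. h (X j s))" for j
    define q where "q = (MAX i\<in>{1..n}. Q (\<xi> i))"
    define r where "r = max 1 (sqrt (\<delta> / \<gamma>))"
    have uw: "u \<in> mho D" "w \<in> mho D"
      using u w mho_mono[of \<Omega> D] mho_mono[of "{0}" D] assms(2,3) by auto
    have X: "X j \<in> mho D" if "j \<le> n + 1" for j
      using string_solution_ext_in_mho[OF x uw that] by (simp add: X_def[abs_def])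
    have Xx: "X j = (\<lambda>s. x s j)" if "j \<in> {1..n}" for j
      using that by (auto simp: X_def ext_state_def)
    have \<xi>D: "\<xi> j \<in> D" if "j \<in> {1..n}" for j
      using \<xi> that by (auto simp: PiE_iff)
    have Qq: "Q (\<xi> j) \<le> q" if "j \<in> {1..n}" for j
      unfolding q_def using that by (intro Max_ge) auto
    have rec: "0 \<le> a j \<and> a j \<le> \<gamma> * a (j - 1) + \<delta> * a (j + 1) + q" if j: "j \<in> {1..n}" for j
    proof -
      have "subsystem_solution D f (X (j - 1)) (X (j + 1)) (\<xi> j) (X j)"
        \<comment> \<open>Only the middle signal becomes a plain component; the neighbours may be
          boundary signals and keep the form \<open>ext_state\<close>.\<close>
        unfolding Xx[OF j] unfolding X_def[abs_def] by (rule string_solution_subsystem[OF x j])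
      then have "a j \<le> \<gamma> * a (j - 1) + \<delta> * a (j + 1) + Q (\<xi> j)"
        using assms(14)[OF \<xi>D[OF j] X X, of "j - 1" "j + 1"] j t unfolding a_def by auto
      then show ?thesis
        using Qq[OF j] by (simp add: a_def Lp_norm_nonneg)
    qed
    \<comment> \<open>Membership in \<open>mho {0}\<close> constrains every nonnegative time. With
      \<open>h 0 = 0\<close> this gives the vanishing boundary value of the recursion.\<close>
    have "w s = 0" if "0 \<le> s" for s
      using w that by (auto simp: mho_def)
    then have "a (n + 1) = 0"
      unfolding a_def by (intro Lp_norm_eq_0) (simp add: X_def ext_state_def assms(6))
    moreover have "0 \<le> q"
      using assms(11)[OF \<xi>D[OF i]] Qq[OF i] by simp
    moreover have r\<theta>: "\<gamma> * r + \<delta> / r = \<theta>"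
      unfolding r_def \<theta>_def by (rule theta_weight[OF assms(12,13)])
    moreover have "1 \<le> r"
      by (simp add: r_def)
    ultimately have "a i \<le> (\<gamma> * a 0 + r ^ (n - 1) * q) / (1 - \<theta>)"
      using tridiagonal_estimate[of r \<gamma> \<delta> q a n i] rec i \<theta> assms(12,13)
      by (simp add: a_def Lp_norm_nonneg)
    also have "r ^ (n - 1) = max 1 ((inverse \<gamma> * \<delta>) powr ((real n - 1) / 2))"
      using power_max_sqrt[of "\<delta> / \<gamma>" "n - 1"] assms(12,13) n
      by (simp add: r_def of_nat_diff field_simps)
    finally have "a i \<le> \<gamma> * a 0 / (1 - \<theta>) + c n * q"
      by (simp add: c_def add_divide_distrib)
    then show "Lp_norm p t (\<lambda>s. h (x s i)) \<le>
        \<gamma> * Lp_norm p t (\<lambda>s. h (u s)) / (1 - \<theta>) + 0 + c n * (MAX i\<in>{1..n}. Q (\<xi> i))"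
      by (simp add: a_def Xx[OF i] q_def) (simp add: X_def ext_state_def)
  qed
  \<comment> \<open>The dependence on \<open>n\<close> sits entirely in \<open>c n\<close> and the
    maximum, so one gain function serves all string lengths.\<close>
  have "string_stable D \<Omega> {0} f h p"
    unfolding string_stable_def
  proof (rule exI[of _ "\<lambda>s. \<gamma> * s / (1 - \<theta>)"], rule exI[of _ "\<lambda>_. 0"], intro conjI allI impI)
    show "\<forall>a\<in>{\<lambda>s. \<gamma> * s / (1 - \<theta>), \<lambda>_. 0}.
        continuous_on {0..} a \<and> mono_on {0..} a \<and> (\<forall>s\<ge>0. 0 \<le> a s)"
      using \<theta> assms(12)
      by (auto intro!: continuous_intros mono_onI divide_right_mono mult_left_mono)
  next
    fix n :: nat
    assume n: "1 \<le> n"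
    then show "forward_complete D \<Omega> {0} f n"
      by (rule assms(8))
    have "continuous_on (state_space n D) (\<lambda>\<xi>. Q (\<xi> i))" if "i \<in> {1..n}" for i
    proof (rule continuous_on_compose2[OF assms(10)])
      show "continuous_on (state_space n D) (\<lambda>\<xi>. \<xi> i)"
        by (rule continuous_on_product_then_coordinatewise) (rule continuous_on_id)
    qed (use that in auto)
    then have "continuous_on (state_space n D) (\<lambda>\<xi>. c n * (MAX i\<in>{1..n}. Q (\<xi> i)))"
      using n by (intro continuous_intros continuous_on_Max_image) auto
    moreover have "0 \<le> c n * (MAX i\<in>{1..n}. Q (\<xi> i))" if "\<xi> \<in> state_space n D" for \<xi>
    proof -
      have "0 \<le> Q (\<xi> 1)"
        using n that by (intro assms(11)) (auto simp: PiE_iff)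
      also have "\<dots> \<le> (MAX i\<in>{1..n}. Q (\<xi> i))"
        using n by (intro Max_ge) auto
      finally show ?thesis
        using c by simp
    qed
    ultimately show "\<exists>Q. continuous_on (state_space n D) Q \<and> (\<forall>\<xi>\<in>state_space n D. 0 \<le> Q \<xi>) \<and>
        string_estimate D \<Omega> {0} f h p n (\<lambda>s. \<gamma> * s / (1 - \<theta>)) (\<lambda>_. 0) Q"
      using est[OF n] by blast
  qed
  then show ?thesis
    using est by (simp add: one_sided_string_stable_def c_def \<theta>_def)
qed

end
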